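(* Let $\Omega$ be a nonempty finite set. The function $\pi$ (defined in the context) from the set of all finite sets of finite lists in $\Omega$ to the set $\mathcal{O}$ of all extended graphs on $\Omega$ is well-defined, injective, and $\operatorname{Sym}(\Omega)$-invariant. Consequently, for all finite sets $A,B$ of finite lists in $\Omega$, the pair of constant functions on $\operatorname{Stacks}(\mathcal{O})$ with images the one-entry stacks $[\pi(A)]$ and $[\pi(B)]$ is a perfect refiner for $\operatorname{Transp}(A,B)$ in extended graph backtracking.
   Context: Actions are right actions, written by exponentiation. A digraph on a set $V$ is a pair $(V,A)$ with arc set $A \subseteq V\times V$ (loops allowed); a labelled digraph on $V$ additionally has a label assigned to each vertex and each arc. $\operatorname{Sym}(V)$ acts on labelled digraphs on $V$ by renaming vertices (carrying labels along). Any action of $\operatorname{Sym}(\Omega)$ on a set induces actions elementwise on its subsets and entrywise on finite lists of its elements (and so on sets of lists). A function $f:X\to Y$ between sets on which $\operatorname{Sym}(\Omega)$ acts is $\operatorname{Sym}(\Omega)$-invariant if $f(x^g)=f(x)^g$ for all $x\in X$, $g\in\operatorname{Sym}(\Omega)$. Fix an infinite well-ordered set $\Lambda\supseteq\Omega$ with $\alpha<\beta$ for all $\alpha\in\Omega$, $\beta\in\Lambda\setminus\Omega$. For $\Omega\subseteq V\subseteq\Lambda$, regard $\operatorname{Sym}(\Omega)$ and $\operatorname{Sym}(V\setminus\Omega)$ as (commuting) subgroups of $\operatorname{Sym}(V)$. An extended graph on $\Omega$ is an orbit $\overline{\Gamma}$ of $\operatorname{Sym}(V\setminus\Omega)$ on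 the set of labelled digraphs on $V$, for some finite $V$ with $\Omega\subseteq V\subseteq\Lambda$. $\operatorname{Sym}(\Omega)$ acts by $(\overline{\Gamma})^g=\overline{\Gamma^g}$. Let $A=\{A_1,\dots,A_k\}$, $k\geq0$, be a set of nonempty lists in $\Omega$, indexed arbitrarily; $A_i[j]$ is the $j$-th entry of $A_i$. Let $r=\sum_{i=1}^k|A_i|$, let $V_r$ be the set of the least $r$ elements of $\Lambda\setminus\Omega$, and let $\rho$ be an arbitrary bijection from $\{(i,j):1\leq i\leq k,\ 1\leq j\leq|A_i|\}$ to $V_r$. Then $\pi(A)$ is the extended graph containing the labelled digraph on $\Omega\cup V_r$ with arcs $$\{(\rho(i,j),A_i[j]):1\leq i\leq k,\ 1\leq j\leq|A_i|\}\cup\{(\rho(i,j),\rho(i,j+1)):1\leq i\leq k,\ 1\leq j<|A_i|\},$$ where vertices in $\Omega$ are labelled white, and vertices in $V_r$ and all arcs are labelled black (two distinct fixed labels). For a set of lists that includes the empty list, apply the same construction to its nonempty members and add one further isolated vertex (the next least element of $\Lambda\setminus\Omega$) with label black. For a set $\mathcal{O}$ on which $\operatorname{Sym}(\Omega)$ acts, $\operatorname{Stacks}(\mathcal{O})$ is the set of all finite lists (including the empty one) with entries in $\mathcal{O}$; $|S|$ is length and $\Vert$ is concatenation. $\operatorname{Transp}(x,y) = \{g\in\operatorname{Sym}(\Omega) : x^g=y\}$. A refiner for $U\subseteq\operatorname{Sym}(\Omega)$ (with respect to $\mathcal{O}$) is a pair $(f_L,f_R)$ of functions from $\operatorname{Stacks}(\mathcal{O})$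 to itself such that $U\cap\operatorname{Transp}(S,T)\subseteq\operatorname{Transp}(f_L(S),f_R(T))$ for all $S,T$. It is perfect if $U\cap\operatorname{Transp}(S,T)=\operatorname{Transp}(S\Vert f_L(S),\,T\Vert f_R(T))$ for all $S,T$ with $|S|=|T|$. Extended graph backtracking is the case where $\mathcal{O}$ is the set of all extended graphs on $\Omega$. *)

theory Defs
  imports "HOL-Library.Infinite_Set" "HOL-Combinatorics.Permutations"
begin

section \<open>Symmetric groups and induced actions\<close>

text \<open>
  Elements of the symmetric group on a set are total functions fixing everything outside that
  set, so that for \<open>\<Omega> \<subseteq> V\<close> the groups on \<open>\<Omega>\<close> and \<open>V - \<Omega>\<close> are literally contained in the group
  on \<open>V\<close>. Actions are right actions: the term \<open>act x g\<close> stands for $x^g$.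
\<close>

definition Sym :: "'a set \<Rightarrow> ('a \<Rightarrow> 'a) set" where
  "Sym X = {g. g permutes X}"

definition pt_act :: "'a \<Rightarrow> ('a \<Rightarrow> 'a) \<Rightarrow> 'a" where
  "pt_act x g = g x"

definition set_act :: "('x \<Rightarrow> 'g \<Rightarrow> 'x) \<Rightarrow> 'x set \<Rightarrow> 'g \<Rightarrow> 'x set" where
  "set_act act X g = (\<lambda>x. act x g) ` X"

definition list_act :: "('x \<Rightarrow> 'g \<Rightarrow> 'x) \<Rightarrow> 'x list \<Rightarrow> 'g \<Rightarrow> 'x list" where
  "list_act act xs g = map (\<lambda>x. act x g) xs"

definition Transp :: "'a set \<Rightarrow> ('x \<Rightarrow> ('a \<Rightarrow> 'a) \<Rightarrow> 'x) \<Rightarrow> 'x \<Rightarrow> 'x \<Rightarrow> ('a \<Rightarrow> 'a) set" where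
  "Transp \<Omega> act x y = {g \<in> Sym \<Omega>. act x g = y}"

definition Sym_invariant ::
  "'a set \<Rightarrow> ('x \<Rightarrow> ('a \<Rightarrow> 'a) \<Rightarrow> 'x) \<Rightarrow> ('y \<Rightarrow> ('a \<Rightarrow> 'a) \<Rightarrow> 'y) \<Rightarrow> 'x set \<Rightarrow> ('x \<Rightarrow> 'y) \<Rightarrow> bool"
where
  "Sym_invariant \<Omega> actX actY X f \<longleftrightarrow> (\<forall>x\<in>X. \<forall>g\<in>Sym \<Omega>. f (actX x g) = actY (f x) g)"

section \<open>Labelled digraphs and extended graphs\<close>

text \<open>
  Labels are given by partial maps whose domains are exactly the vertex set and the arc set, so
  that equality of records is equality of labelled digraphs.
\<close>

record ('a, 'l) ldigraph =
  verts :: "'a set"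
  arcs :: "('a \<times> 'a) set"
  vlabel :: "'a \<rightharpoonup> 'l"
  alabel :: "'a \<times> 'a \<rightharpoonup> 'l"

definition ldigraphs_on :: "'a set \<Rightarrow> ('a, 'l) ldigraph set" where
  "ldigraphs_on V =
     {\<Gamma>. verts \<Gamma> = V \<and> arcs \<Gamma> \<subseteq> V \<times> V \<and> dom (vlabel \<Gamma>) = V \<and> dom (alabel \<Gamma>) = arcs \<Gamma>}"

definition ldigraph_act :: "('a, 'l) ldigraph \<Rightarrow> ('a \<Rightarrow> 'a) \<Rightarrow> ('a, 'l) ldigraph" where
  "ldigraph_act \<Gamma> g =
     \<lparr> verts = g ` verts \<Gamma>,
       arcs = map_prod g g ` arcs \<Gamma>,
       vlabel = vlabel \<Gamma> \<circ> inv g,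
       alabel = alabel \<Gamma> \<circ> map_prod (inv g) (inv g) \<rparr>"

definition ext_orbit :: "'a set \<Rightarrow> ('a, 'l) ldigraph \<Rightarrow> ('a, 'l) ldigraph set" where
  "ext_orbit \<Omega> \<Gamma> = ldigraph_act \<Gamma> ` Sym (verts \<Gamma> - \<Omega>)"

definition ext_graphs :: "'a set \<Rightarrow> 'a set \<Rightarrow> ('a, 'l) ldigraph set set" where
  "ext_graphs \<Omega> \<Lambda> =
     {ext_orbit \<Omega> \<Gamma> | \<Gamma> V. finite V \<and> \<Omega> \<subseteq> V \<and> V \<subseteq> \<Lambda> \<and> \<Gamma> \<in> ldigraphs_on V}"

text \<open>
  The action on extended graphs is the elementwise one; \<open>ext_act_ext_orbit\<close> below shows that it
  maps the extended graph of \<open>\<Gamma>\<close> to the extended graph of $\Gamma^g$.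
\<close>

abbreviation ext_act :: "('a, 'l) ldigraph set \<Rightarrow> ('a \<Rightarrow> 'a) \<Rightarrow> ('a, 'l) ldigraph set" where
  "ext_act \<equiv> set_act ldigraph_act"

lemma ldigraph_act_comp:
  assumes "bij g" "bij h"
  shows "ldigraph_act (ldigraph_act \<Gamma> g) h = ldigraph_act \<Gamma> (h \<circ> g)"
  using assms
  by (simp add: ldigraph_act_def o_inv_distrib image_comp map_prod.comp o_assoc [symmetric])

lemma permutes_disjoint_commute:
  assumes "g permutes X" "h permutes Y" "X \<inter> Y = {}"
  shows "g \<circ> h = h \<circ> g"
proof
  fix x
  have "h x \<notin> X" if "x \<in> Y" using that assms by (metis disjoint_iff permutes_in_image)
  moreover have "g x \<notin> Y" if "x \<in> X" using that assms by (metis disjoint_iff permutes_in_image)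
  ultimately show "(g \<circ> h) x = (h \<circ> g) x"
    using assms by (cases "x \<in> X"; cases "x \<in> Y") (auto simp: permutes_not_in)
qed

lemma ext_act_ext_orbit:
  assumes "g \<in> Sym \<Omega>" "\<Omega> \<subseteq> verts \<Gamma>"
  shows "ext_act (ext_orbit \<Omega> \<Gamma>) g = ext_orbit \<Omega> (ldigraph_act \<Gamma> g)"
proof -
  have g: "g permutes \<Omega>" using assms by (simp add: Sym_def)
  have "g ` verts \<Gamma> = verts \<Gamma>"
    using permutes_image[OF permutes_subset[OF g assms(2)]] .
  moreover have "ldigraph_act (ldigraph_act \<Gamma> h) g = ldigraph_act (ldigraph_act \<Gamma> g) h"
    if "h permutes verts \<Gamma> - \<Omega>" for h
    using permutes_disjoint_commute[OF g that] permutes_bij[OF g] permutes_bij[OF that]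
    by (simp add: ldigraph_act_comp)
  ultimately show ?thesis
    by (auto simp: ext_orbit_def set_act_def image_image Sym_def ldigraph_act_def
        intro!: image_cong)
qed

lemma ldigraph_act_in_ldigraphs_on:
  assumes "g permutes V" "\<Gamma> \<in> ldigraphs_on V"
  shows "ldigraph_act \<Gamma> g \<in> ldigraphs_on V"
proof -
  have b: "bij g" using assms(1) by (rule permutes_bij)
  have V: "verts \<Gamma> = V" "arcs \<Gamma> \<subseteq> V \<times> V" "dom (vlabel \<Gamma>) = V" "dom (alabel \<Gamma>) = arcs \<Gamma>"
    using assms(2) by (auto simp: ldigraphs_on_def)
  have g: "g ` V = V" using assms(1) by (rule permutes_image)
  have "dom (vlabel \<Gamma> \<circ> inv g) = inv g -` V"
    using V(3) by (auto simp: dom_def)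
  also have "\<dots> = V" using b g by (metis bij_vimage_eq_inv_image bij_imp_bij_inv inv_inv_eq)
  finally have v: "dom (vlabel \<Gamma> \<circ> inv g) = V" .
  have "dom (alabel \<Gamma> \<circ> map_prod (inv g) (inv g)) = map_prod (inv g) (inv g) -` arcs \<Gamma>"
    using V(4) by (auto simp: dom_def)
  also have "\<dots> = map_prod g g ` arcs \<Gamma>"
  proof (intro set_eqI iffI)
    fix e assume "e \<in> map_prod (inv g) (inv g) -` arcs \<Gamma>"
    moreover have "e = map_prod g g (map_prod (inv g) (inv g) e)"
      using b by (cases e) (simp add: bij_is_surj surj_f_inv_f)
    ultimately show "e \<in> map_prod g g ` arcs \<Gamma>" by (metis image_eqI vimage_eq)
  next
    fix e assume "e \<in> map_prod g g ` arcs \<Gamma>"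
    then show "e \<in> map_prod (inv g) (inv g) -` arcs \<Gamma>"
      using b by (auto simp: bij_is_inj)
  qed
  finally have a: "dom (alabel \<Gamma> \<circ> map_prod (inv g) (inv g)) = map_prod g g ` arcs \<Gamma>" .
  have "map_prod g g ` arcs \<Gamma> \<subseteq> V \<times> V" using V(2) g by auto
  with v a g V(1) show ?thesis by (simp add: ldigraphs_on_def ldigraph_act_def)
qed

lemma ext_act_in_ext_graphs:
  assumes "g \<in> Sym \<Omega>" "X \<in> ext_graphs \<Omega> \<Lambda>"
  shows "ext_act X g \<in> ext_graphs \<Omega> \<Lambda>"
proof -
  obtain \<Gamma> V where *: "X = ext_orbit \<Omega> \<Gamma>" "finite V" "\<Omega> \<subseteq> V" "V \<subseteq> \<Lambda>" "\<Gamma> \<in> ldigraphs_on V"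
    using assms(2) by (auto simp: ext_graphs_def)
  have "g permutes V" using assms(1) *(3) by (auto simp: Sym_def intro: permutes_subset)
  then have "ldigraph_act \<Gamma> g \<in> ldigraphs_on V" using *(5) by (rule ldigraph_act_in_ldigraphs_on)
  moreover have "ext_act X g = ext_orbit \<Omega> (ldigraph_act \<Gamma> g)"
    using * assms(1) by (simp add: ext_act_ext_orbit ldigraphs_on_def)
  ultimately show ?thesis using * by (auto simp: ext_graphs_def)
qed

section \<open>Stacks and refiners\<close>

text \<open>Stacks over a set \<open>X\<close> of objects are the members of \<open>lists X\<close>.\<close>

definition refiner ::
  "'a set \<Rightarrow> 'x set \<Rightarrow> ('x \<Rightarrow> ('a \<Rightarrow> 'a) \<Rightarrow> 'x) \<Rightarrow> ('a \<Rightarrow> 'a) set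
    \<Rightarrow> ('x list \<Rightarrow> 'x list) \<Rightarrow> ('x list \<Rightarrow> 'x list) \<Rightarrow> bool"
where
  "refiner \<Omega> X act U fL fR \<longleftrightarrow>
     U \<subseteq> Sym \<Omega> \<and> fL \<in> lists X \<rightarrow> lists X \<and> fR \<in> lists X \<rightarrow> lists X \<and>
     (\<forall>S\<in>lists X. \<forall>T\<in>lists X.
        U \<inter> Transp \<Omega> (list_act act) S T \<subseteq> Transp \<Omega> (list_act act) (fL S) (fR T))"

definition perfect_refiner ::
  "'a set \<Rightarrow> 'x set \<Rightarrow> ('x \<Rightarrow> ('a \<Rightarrow> 'a) \<Rightarrow> 'x) \<Rightarrow> ('a \<Rightarrow> 'a) set
    \<Rightarrow> ('x list \<Rightarrow> 'x list) \<Rightarrow> ('x list \<Rightarrow> 'x list) \<Rightarrow> bool"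
where
  "perfect_refiner \<Omega> X act U fL fR \<longleftrightarrow>
     refiner \<Omega> X act U fL fR \<and>
     (\<forall>S\<in>lists X. \<forall>T\<in>lists X. length S = length T \<longrightarrow>
        U \<inter> Transp \<Omega> (list_act act) S T = Transp \<Omega> (list_act act) (S @ fL S) (T @ fR T))"

section \<open>The extended graph of a finite set of finite lists\<close>

text \<open>
  The construction depends on an enumeration \<open>As\<close> of the nonempty members of \<open>A\<close> and on a
  bijection \<open>\<rho>\<close> from the positions in these lists to new vertices. Lists and positions are
  counted from 0. For infinite \<open>X\<close>, the elements \<open>enumerate X 0 < enumerate X 1 < \<dots>\<close> are the
  least elements of \<open>X\<close>, in increasing order.
\<close>

definition least_elems :: "'a::wellorder set \<Rightarrow> nat \<Rightarrow> 'a set" where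
  "least_elems X n = enumerate X ` {..<n}"

definition total_length :: "'a list list \<Rightarrow> nat" where
  "total_length As = (\<Sum>xs\<leftarrow>As. length xs)"

definition pi_choice ::
  "'a::wellorder set \<Rightarrow> 'a set \<Rightarrow> 'a list set \<Rightarrow> 'a list list \<Rightarrow> (nat \<times> nat \<Rightarrow> 'a) \<Rightarrow> bool"
where
  "pi_choice \<Omega> \<Lambda> A As \<rho> \<longleftrightarrow>
     distinct As \<and> set As = A - {[]} \<and>
     bij_betw \<rho> (SIGMA i:{..<length As}. {..<length (As ! i)})
       (least_elems (\<Lambda> - \<Omega>) (total_length As))"

definition pi_arcs :: "'a list list \<Rightarrow> (nat \<times> nat \<Rightarrow> 'a) \<Rightarrow> ('a \<times> 'a) set" where
  "pi_arcs As \<rho> =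
     {(\<rho> (i, j), As ! i ! j) | i j. i < length As \<and> j < length (As ! i)} \<union>
     {(\<rho> (i, j), \<rho> (i, Suc j)) | i j. i < length As \<and> Suc j < length (As ! i)}"

definition pi_new_verts ::
  "'a::wellorder set \<Rightarrow> 'a set \<Rightarrow> 'a list set \<Rightarrow> 'a list list \<Rightarrow> 'a set"
where
  "pi_new_verts \<Omega> \<Lambda> A As =
     least_elems (\<Lambda> - \<Omega>) (total_length As) \<union>
     (if [] \<in> A then {enumerate (\<Lambda> - \<Omega>) (total_length As)} else {})"

definition pi_ldigraph ::
  "'a::wellorder set \<Rightarrow> 'a set \<Rightarrow> 'l \<Rightarrow> 'l \<Rightarrow> 'a list set \<Rightarrow> 'a list list \<Rightarrow> (nat \<times> nat \<Rightarrow> 'a)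
    \<Rightarrow> ('a, 'l) ldigraph"
where
  "pi_ldigraph \<Omega> \<Lambda> white black A As \<rho> =
     \<lparr> verts = \<Omega> \<union> pi_new_verts \<Omega> \<Lambda> A As,
       arcs = pi_arcs As \<rho>,
       vlabel = (\<lambda>v. if v \<in> \<Omega> then Some white
                     else if v \<in> pi_new_verts \<Omega> \<Lambda> A As then Some black else None),
       alabel = (\<lambda>e. if e \<in> pi_arcs As \<rho> then Some black else None) \<rparr>"

definition ext_pi ::
  "'a::wellorder set \<Rightarrow> 'a set \<Rightarrow> 'l \<Rightarrow> 'l \<Rightarrow> 'a list set \<Rightarrow> ('a, 'l) ldigraph set"
where
  "ext_pi \<Omega> \<Lambda> white black A =
     (THE X. X \<in> ext_graphs \<Omega> \<Lambda> \<and>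
        (\<exists>As \<rho>. pi_choice \<Omega> \<Lambda> A As \<rho> \<and> pi_ldigraph \<Omega> \<Lambda> white black A As \<rho> \<in> X))"

text \<open>
  Well-definedness: choices exist, and for every choice the resulting labelled digraph lies in
  exactly one extended graph, which is the same one for all choices.
\<close>

definition ext_pi_well_defined ::
  "'a::wellorder set \<Rightarrow> 'a set \<Rightarrow> 'l \<Rightarrow> 'l \<Rightarrow> 'a list set \<Rightarrow> bool"
where
  "ext_pi_well_defined \<Omega> \<Lambda> white black A \<longleftrightarrow>
     (\<exists>As \<rho>. pi_choice \<Omega> \<Lambda> A As \<rho>) \<and>
     (\<exists>X\<in>ext_graphs \<Omega> \<Lambda>. \<forall>As \<rho>. pi_choice \<Omega> \<Lambda> A As \<rho> \<longrightarrow>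
        (\<forall>Y\<in>ext_graphs \<Omega> \<Lambda>. pi_ldigraph \<Omega> \<Lambda> white black A As \<rho> \<in> Y \<longleftrightarrow> Y = X))"

end

theory Submission imports Defs begin

text \<open>
  The set \<open>A\<close> can be read off any labelled digraph in \<open>\<pi>(A)\<close>: its nonempty members are the label
  sequences of the maximal directed paths outside \<open>\<Omega>\<close>, and it contains the empty list iff some
  vertex outside \<open>\<Omega>\<close> has no outgoing arc. This reading is unaffected by permuting the vertices
  outside \<open>\<Omega>\<close>, so \<open>\<pi>\<close> is injective. Being injective and invariant, \<open>\<pi>\<close> transports transporters:
  $\operatorname{Transp}(A,B) = \operatorname{Transp}(\pi(A),\pi(B))$.
\<close>

section \<open>Orbits under permutations of the new vertices\<close>

lemma verts_ldigraph_act_Sym: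
  assumes "h \<in> Sym (verts \<Gamma> - \<Omega>)"
  shows "verts (ldigraph_act \<Gamma> h) = verts \<Gamma>"
proof -
  have "h permutes verts \<Gamma>"
    using assms by (auto simp: Sym_def intro: permutes_subset)
  then show ?thesis by (simp add: ldigraph_act_def permutes_image)
qed

lemma ext_orbit_self: "\<Gamma> \<in> ext_orbit \<Omega> \<Gamma>"
proof -
  have "ldigraph_act \<Gamma> id = \<Gamma>" by (simp add: ldigraph_act_def map_prod.id)
  then show ?thesis unfolding ext_orbit_def Sym_def
    by (metis (mono_tags) image_eqI mem_Collect_eq permutes_id)
qed

text \<open>The usual argument for orbits of a group: the acting group depends on the digraph only
  through its vertex set, which its own elements preserve, so both orbits come from the same
  group.\<close>

lemma ext_orbit_eq:
  assumes "\<Gamma>' \<in> ext_orbit \<Omega> \<Gamma>"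
  shows "ext_orbit \<Omega> \<Gamma>' = ext_orbit \<Omega> \<Gamma>"
proof -
  obtain h where h: "h permutes verts \<Gamma> - \<Omega>" and \<Gamma>': "\<Gamma>' = ldigraph_act \<Gamma> h"
    using assms by (auto simp: ext_orbit_def Sym_def)
  have v: "verts \<Gamma>' = verts \<Gamma>"
    using verts_ldigraph_act_Sym h by (auto simp: \<Gamma>' Sym_def)
  have act: "ldigraph_act \<Gamma>' k = ldigraph_act \<Gamma> (k \<circ> h)" if "k permutes verts \<Gamma> - \<Omega>" for k
    using that h by (simp add: \<Gamma>' ldigraph_act_comp permutes_bij)
  show ?thesis
  proof (intro set_eqI iffI)
    fix \<Delta> assume "\<Delta> \<in> ext_orbit \<Omega> \<Gamma>'"
    then obtain k where "k permutes verts \<Gamma> - \<Omega>" "\<Delta> = ldigraph_act \<Gamma> (k \<circ> h)"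
      using act by (auto simp: ext_orbit_def v Sym_def)
    then show "\<Delta> \<in> ext_orbit \<Omega> \<Gamma>"
      using permutes_compose[OF h] by (auto simp: ext_orbit_def Sym_def)
  next
    fix \<Delta> assume "\<Delta> \<in> ext_orbit \<Omega> \<Gamma>"
    then obtain k where k: "k permutes verts \<Gamma> - \<Omega>" "\<Delta> = ldigraph_act \<Gamma> k"
      by (auto simp: ext_orbit_def Sym_def)
    \<comment> \<open>To reach \<open>\<Delta>\<close> from \<open>\<Gamma>'\<close>, first undo
      \<open>h\<close>, then apply \<open>k\<close>.\<close>
    have "k \<circ> inv h permutes verts \<Gamma> - \<Omega>"
      using k(1) h by (simp add: permutes_compose permutes_inv)
    moreover have "\<Delta> = ldigraph_act \<Gamma>' (k \<circ> inv h)"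
      using act[OF calculation] k(2) permutes_inv_o(2)[OF h] by (simp add: o_assoc [symmetric])
    ultimately show "\<Delta> \<in> ext_orbit \<Omega> \<Gamma>'"
      by (auto simp: ext_orbit_def v Sym_def)
  qed
qed

text \<open>Extended graphs are pairwise disjoint, even for different vertex sets, so each is
  determined by any one of its members.\<close>

lemma ext_graphs_containing:
  assumes "\<Gamma> \<in> Y" "Y \<in> ext_graphs \<Omega> \<Lambda>"
  shows "Y = ext_orbit \<Omega> \<Gamma>"
  using assms ext_orbit_eq by (fastforce simp: ext_graphs_def)

section \<open>New vertices and existence of choices\<close>

lemma least_elems_subset:
  assumes "infinite X"
  shows "least_elems X n \<subseteq> X"
  using assms by (auto simp: least_elems_def enumerate_in_set)

lemma finite_least_elems [simp]: "finite (least_elems X n)"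
  by (simp add: least_elems_def)

lemma card_least_elems:
  assumes "infinite X"
  shows "card (least_elems X n) = n"
  using inj_on_subset[OF inj_enumerate[OF assms] subset_UNIV] by (simp add: least_elems_def card_image)

text \<open>Keeps the isolated vertex that stands for the empty list apart from the vertices of the
  nonempty lists.\<close>

lemma enumerate_notin_least_elems:
  assumes "infinite X"
  shows "enumerate X n \<notin> least_elems X n"
  using inj_enumerate[OF assms] by (auto simp: least_elems_def inj_def)

lemma pi_new_verts_subset:
  assumes "infinite (\<Lambda> - \<Omega>)"
  shows "pi_new_verts \<Omega> \<Lambda> A As \<subseteq> \<Lambda> - \<Omega>"
  using least_elems_subset[OF assms] enumerate_in_set[OF assms] by (auto simp: pi_new_verts_def)

lemma pi_choice_range:
  assumes "pi_choice \<Omega> \<Lambda> A As \<rho>" "i < length As" "j < length (As ! i)"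
  shows "\<rho> (i, j) \<in> least_elems (\<Lambda> - \<Omega>) (total_length As)"
  using assms by (auto simp: pi_choice_def bij_betw_def)

lemma pi_choice_inj:
  assumes "pi_choice \<Omega> \<Lambda> A As \<rho>" "\<rho> (i, j) = \<rho> (i', j')"
    and "i < length As" "j < length (As ! i)" "i' < length As" "j' < length (As ! i')"
  shows "i = i' \<and> j = j'"
proof -
  have "inj_on \<rho> (SIGMA i:{..<length As}. {..<length (As ! i)})"
    using assms(1) by (simp add: pi_choice_def bij_betw_def)
  from inj_onD[OF this assms(2)] show ?thesis using assms(3-) by auto
qed

lemma total_length_eq:
  assumes "distinct As" "distinct Bs" "set As = set Bs"
  shows "total_length As = total_length Bs"
  using assms by (simp add: total_length_def sum_list_distinct_conv_sum_set)

lemma pi_choice_exists: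
  assumes "finite A" "infinite (\<Lambda> - \<Omega>)"
  shows "\<exists>As \<rho>. pi_choice \<Omega> \<Lambda> A As \<rho>"
proof -
  obtain As where As: "distinct As" "set As = A - {[]}"
    using finite_distinct_list[of "A - {[]}"] assms(1) by auto
  \<comment> \<open>There are as many positions as new vertices reserved for them, which yields the
    bijection \<open>\<rho>\<close>.\<close>
  have "card (SIGMA i:{..<length As}. {..<length (As ! i)}) = total_length As"
    by (simp add: total_length_def sum_list_sum_nth atLeast0LessThan)
  then obtain \<rho> where "bij_betw \<rho> (SIGMA i:{..<length As}. {..<length (As ! i)})
      (least_elems (\<Lambda> - \<Omega>) (total_length As))"
    using finite_same_card_bij[OF _ finite_least_elems] card_least_elems[OF assms(2)]
    by (metis (no_types, lifting) finite_SigmaI finite_lessThan)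
  then show ?thesis using As by (auto simp: pi_choice_def)
qed

section \<open>Independence of the choices and well-definedness\<close>

text \<open>Serves two situations: a change of enumeration and bijection, where \<open>h\<close>
  moves new vertices and \<open>\<sigma>\<close> reindexes the lists, and the action of
  Sym(\<Omega>), where \<open>h\<close> moves points of \<Omega> and \<open>\<sigma>\<close> is the
  identity.\<close>

lemma map_prod_pi_arcs:
  assumes \<sigma>: "bij_betw \<sigma> {..<length As} {..<length Bs}"
    and Bs: "\<And>i. i < length As \<Longrightarrow> Bs ! \<sigma> i = map h (As ! i)"
    and \<rho>: "\<And>i j. i < length As \<Longrightarrow> j < length (As ! i) \<Longrightarrow> \<rho>' (\<sigma> i, j) = h (\<rho> (i, j))"
  shows "map_prod h h ` pi_arcs As \<rho> = pi_arcs Bs \<rho>'"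
proof (intro set_eqI iffI)
  fix e assume "e \<in> map_prod h h ` pi_arcs As \<rho>"
  then consider i j where "i < length As" "j < length (As ! i)"
      "e = (h (\<rho> (i, j)), h (As ! i ! j))"
    | i j where "i < length As" "Suc j < length (As ! i)"
      "e = (h (\<rho> (i, j)), h (\<rho> (i, Suc j)))"
    by (auto simp: pi_arcs_def)
  then show "e \<in> pi_arcs Bs \<rho>'"
  proof cases
    case 1
    then have "\<sigma> i < length Bs" "j < length (Bs ! \<sigma> i)" "e = (\<rho>' (\<sigma> i, j), Bs ! \<sigma> i ! j)"
      using bij_betwE[OF \<sigma>] Bs \<rho> by auto
    then show ?thesis unfolding pi_arcs_def by blast
  next
    case 2
    then have "\<sigma> i < length Bs" "Suc j < length (Bs ! \<sigma> i)"
        "e = (\<rho>' (\<sigma> i, j), \<rho>' (\<sigma> i, Suc j))"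
      using bij_betwE[OF \<sigma>] Bs \<rho> by auto
    then show ?thesis unfolding pi_arcs_def by blast
  qed
next
  fix e assume "e \<in> pi_arcs Bs \<rho>'"
  then consider i j where "i < length Bs" "j < length (Bs ! i)" "e = (\<rho>' (i, j), Bs ! i ! j)"
    | i j where "i < length Bs" "Suc j < length (Bs ! i)" "e = (\<rho>' (i, j), \<rho>' (i, Suc j))"
    by (auto simp: pi_arcs_def)
  then show "e \<in> map_prod h h ` pi_arcs As \<rho>"
  proof cases
    case 1
    obtain k where k: "k < length As" "i = \<sigma> k"
      using 1(1) \<sigma> by (auto simp: bij_betw_def)
    then have "j < length (As ! k)" "e = map_prod h h (\<rho> (k, j), As ! k ! j)"
      using 1 Bs \<rho> by auto
    then show ?thesis unfolding pi_arcs_def using k(1) by blast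
  next
    case 2
    obtain k where k: "k < length As" "i = \<sigma> k"
      using 2(1) \<sigma> by (auto simp: bij_betw_def)
    then have "Suc j < length (As ! k)" "e = map_prod h h (\<rho> (k, j), \<rho> (k, Suc j))"
      using 2 Bs \<rho> by auto
    then show ?thesis unfolding pi_arcs_def using k(1) by blast
  qed
qed

text \<open>Labels follow automatically: a vertex label depends only on whether the vertex lies in
  \<Omega> or is new, and all arcs have the same label.\<close>

lemma ldigraph_act_pi_ldigraph:
  assumes h: "bij h" and \<Omega>: "h ` \<Omega> = \<Omega>"
    and N: "h ` pi_new_verts \<Omega> \<Lambda> A As = pi_new_verts \<Omega> \<Lambda> B Bs"
    and arcs: "map_prod h h ` pi_arcs As \<rho> = pi_arcs Bs \<rho>'"
  shows "ldigraph_act (pi_ldigraph \<Omega> \<Lambda> white black A As \<rho>) h =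
    pi_ldigraph \<Omega> \<Lambda> white black B Bs \<rho>'"
proof -
  \<comment> \<open>The action pulls labels back along \<open>inv h\<close>, while the hypotheses
    speak of images under \<open>h\<close>; this and the next fact translate between them.\<close>
  have inv: "inv h v \<in> X \<longleftrightarrow> v \<in> h ` X" for v X
    using h by (metis bij_inv_eq_iff image_iff)
  have invp: "map_prod (inv h) (inv h) e \<in> X \<longleftrightarrow> e \<in> map_prod h h ` X" for e X
  proof -
    have "map_prod h h (map_prod (inv h) (inv h) e) = e"
      using h by (cases e) (simp add: bij_is_surj surj_f_inv_f)
    moreover have "map_prod (inv h) (inv h) (map_prod h h e') = e'" for e'
      using h by (cases e') (simp add: bij_is_inj)
    ultimately show ?thesis
      by (intro iffI; (metis imageI | force))
  qed
  show ?thesis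
    by (simp add: ldigraph_act_def pi_ldigraph_def image_Un \<Omega> N arcs inv invp fun_eq_iff)
qed

text \<open>Match each list with its index in the other enumeration, and send the new vertex of each
  position to the new vertex of the same position in the same list. This is a permutation of the new
  vertices that carries one digraph to the other.\<close>

lemma pi_ldigraph_same_orbit:
  assumes inf: "infinite (\<Lambda> - \<Omega>)" and "\<Union> (set ` A) \<subseteq> \<Omega>"
    and c: "pi_choice \<Omega> \<Lambda> A As \<rho>" and c': "pi_choice \<Omega> \<Lambda> A Bs \<rho>'"
  shows "pi_ldigraph \<Omega> \<Lambda> white black A Bs \<rho>' \<in>
    ext_orbit \<Omega> (pi_ldigraph \<Omega> \<Lambda> white black A As \<rho>)"
proof -
  let ?PA = "SIGMA i:{..<length As}. {..<length (As ! i)}"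
  let ?PB = "SIGMA i:{..<length Bs}. {..<length (Bs ! i)}"
  have d: "distinct As" "distinct Bs" "set As = set Bs" "set As \<subseteq> A"
    using c c' by (auto simp: pi_choice_def)
  \<comment> \<open>Both choices thus use the same vertices for positions, and the same extra vertex
    if the empty list is present.\<close>
  have len: "total_length Bs = total_length As" using d total_length_eq by metis
  define L where "L = least_elems (\<Lambda> - \<Omega>) (total_length As)"
  have \<rho>: "bij_betw \<rho> ?PA L" and \<rho>': "bij_betw \<rho>' ?PB L"
    using c c' len by (auto simp: pi_choice_def L_def)
  \<comment> \<open>The index in \<open>Bs\<close> of the list \<open>As ! i\<close>, unique because
    \<open>Bs\<close> is distinct.\<close>
  define \<sigma> where "\<sigma> i = inv_into {..<length Bs} ((!) Bs) (As ! i)" for i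
  have bA: "bij_betw ((!) As) {..<length As} (set As)"
    and bB: "bij_betw ((!) Bs) {..<length Bs} (set As)"
    using d by (auto intro!: bij_betw_nth)
  have \<sigma>: "bij_betw \<sigma> {..<length As} {..<length Bs}"
    using bij_betw_trans[OF bA bij_betw_inv_into[OF bB]] by (simp add: \<sigma>_def[abs_def] comp_def)
  have Bs: "Bs ! \<sigma> i = As ! i" if "i < length As" for i
    using that bB by (simp add: \<sigma>_def bij_betw_inv_into_right)
  have P: "bij_betw (map_prod \<sigma> id) ?PA ?PB"
  proof (intro bij_betw_imageI)
    show "inj_on (map_prod \<sigma> id) ?PA"
      using bij_betw_imp_inj_on[OF \<sigma>] by (auto simp: inj_on_def)
    show "map_prod \<sigma> id ` ?PA = ?PB"
    proof (intro set_eqI iffI)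
      fix p assume "p \<in> map_prod \<sigma> id ` ?PA"
      then show "p \<in> ?PB" using bij_betwE[OF \<sigma>] Bs by auto
    next
      fix p assume p: "p \<in> ?PB"
      obtain i j where ij: "p = (i, j)" by (cases p)
      obtain k where "k < length As" "i = \<sigma> k"
        using p ij \<sigma> by (auto simp: bij_betw_def)
      then have "p = map_prod \<sigma> id (k, j)" "(k, j) \<in> ?PA" using p ij Bs by auto
      then show "p \<in> map_prod \<sigma> id ` ?PA" by blast
    qed
  qed
  \<comment> \<open>Read off the position of \<open>v\<close> by \<open>\<rho>\<close>, reindex its
    list, and place it by \<open>\<rho>'\<close>. Being the identity off \<open>L\<close>, the map
    fixes \<Omega> and the vertex for the empty list.\<close>
  define h where "h v = (if v \<in> L then \<rho>' (map_prod \<sigma> id (inv_into ?PA \<rho> v)) else v)" for v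
  have hL: "bij_betw h L L"
  proof -
    have "bij_betw (\<rho>' \<circ> map_prod \<sigma> id \<circ> inv_into ?PA \<rho>) L L"
      using bij_betw_inv_into[OF \<rho>] P \<rho>' by (blast intro: bij_betw_trans)
    then show ?thesis by (rule bij_betw_cong[THEN iffD1, rotated]) (simp add: h_def)
  qed
  then have hp: "h permutes L" by (rule bij_imp_permutes) (simp add: h_def)
  have L\<Omega>: "L \<inter> \<Omega> = {}" using least_elems_subset[OF inf] by (auto simp: L_def)
  have hfix: "h v = v" if "v \<notin> L" for v using that by (simp add: h_def)
  have arcs: "map_prod h h ` pi_arcs As \<rho> = pi_arcs Bs \<rho>'"
  proof (rule map_prod_pi_arcs[OF \<sigma>])
    fix i assume i: "i < length As"
    have "set (As ! i) \<subseteq> \<Omega>" using nth_mem[OF i] d(4) assms(2) by blast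
    then show "Bs ! \<sigma> i = map h (As ! i)"
      using Bs[OF i] hfix L\<Omega> by (auto intro!: map_idI[symmetric])
    fix j assume "j < length (As ! i)"
    then have "(i, j) \<in> ?PA" using i by simp
    then show "\<rho>' (\<sigma> i, j) = h (\<rho> (i, j))"
      using bij_betwE[OF \<rho>] bij_betw_inv_into_left[OF \<rho>] by (simp add: h_def)
  qed
  let ?\<Gamma> = "pi_ldigraph \<Omega> \<Lambda> white black A As \<rho>"
  have N: "h ` pi_new_verts \<Omega> \<Lambda> A As = pi_new_verts \<Omega> \<Lambda> A Bs"
    using permutes_image[OF hp] enumerate_notin_least_elems[OF inf] hfix
    by (auto simp: pi_new_verts_def len L_def[symmetric] image_Un)
  have "h ` \<Omega> = \<Omega>" using hfix L\<Omega> by force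
  then have "ldigraph_act ?\<Gamma> h = pi_ldigraph \<Omega> \<Lambda> white black A Bs \<rho>'"
    using N arcs by (intro ldigraph_act_pi_ldigraph permutes_bij[OF hp])
  moreover have "h permutes verts ?\<Gamma> - \<Omega>"
    using L\<Omega> by (intro permutes_subset[OF hp]) (auto simp: pi_ldigraph_def pi_new_verts_def L_def)
  ultimately show ?thesis unfolding ext_orbit_def Sym_def by (metis image_eqI mem_Collect_eq)
qed

lemma ext_orbit_pi_ldigraph_in_ext_graphs:
  assumes "finite \<Omega>" "\<Omega> \<subseteq> \<Lambda>" "infinite (\<Lambda> - \<Omega>)" "\<Union> (set ` A) \<subseteq> \<Omega>"
    and c: "pi_choice \<Omega> \<Lambda> A As \<rho>"
  shows "ext_orbit \<Omega> (pi_ldigraph \<Omega> \<Lambda> white black A As \<rho>) \<in> ext_graphs \<Omega> \<Lambda>"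
proof -
  let ?\<Gamma> = "pi_ldigraph \<Omega> \<Lambda> white black A As \<rho>"
  let ?N = "pi_new_verts \<Omega> \<Lambda> A As"
  have \<rho>: "\<rho> (i, j) \<in> ?N" if "i < length As" "j < length (As ! i)" for i j
    using pi_choice_range[OF c that] by (simp add: pi_new_verts_def)
  have "As ! i ! j \<in> \<Omega>" if "i < length As" "j < length (As ! i)" for i j
  proof -
    have "As ! i \<in> A" using c nth_mem[OF that(1)] by (auto simp: pi_choice_def)
    then show ?thesis using assms(4) nth_mem[OF that(2)] by blast
  qed
  then have "pi_arcs As \<rho> \<subseteq> (\<Omega> \<union> ?N) \<times> (\<Omega> \<union> ?N)"
    using \<rho> by (auto simp: pi_arcs_def)
  then have "?\<Gamma> \<in> ldigraphs_on (\<Omega> \<union> ?N)"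
    by (auto simp: ldigraphs_on_def pi_ldigraph_def dom_def split: if_splits)
  moreover have "finite (\<Omega> \<union> ?N)" using assms(1) by (simp add: pi_new_verts_def)
  moreover have "\<Omega> \<union> ?N \<subseteq> \<Lambda>" using pi_new_verts_subset[OF assms(3), of A As] assms(2) by blast
  ultimately show ?thesis unfolding ext_graphs_def by blast
qed

text \<open>One fixed choice \<open>As\<close>, \<open>\<rho>\<close> describes the extended graph
  for every other choice. This gives both well-definedness and the uniqueness needed for
  \<open>THE\<close> in \<open>ext_pi\<close>.\<close>

lemma pi_ldigraph_in_ext_graph_iff:
  assumes "finite \<Omega>" "\<Omega> \<subseteq> \<Lambda>" "infinite (\<Lambda> - \<Omega>)" "\<Union> (set ` A) \<subseteq> \<Omega>"
    and c: "pi_choice \<Omega> \<Lambda> A As \<rho>" and c': "pi_choice \<Omega> \<Lambda> A Bs \<rho>'"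
    and "Y \<in> ext_graphs \<Omega> \<Lambda>"
  shows "pi_ldigraph \<Omega> \<Lambda> white black A Bs \<rho>' \<in> Y \<longleftrightarrow>
    Y = ext_orbit \<Omega> (pi_ldigraph \<Omega> \<Lambda> white black A As \<rho>)"
  using ext_graphs_containing[OF _ assms(7)] pi_ldigraph_same_orbit[OF assms(3,4) c c'] ext_orbit_eq
  by metis

lemma ext_pi_well_definedI:
  assumes "finite \<Omega>" "\<Omega> \<subseteq> \<Lambda>" "infinite (\<Lambda> - \<Omega>)" "finite A" "\<Union> (set ` A) \<subseteq> \<Omega>"
  shows "ext_pi_well_defined \<Omega> \<Lambda> white black A"
proof -
  obtain As \<rho> where c: "pi_choice \<Omega> \<Lambda> A As \<rho>"
    using pi_choice_exists[OF assms(4,3)] by blast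
  show ?thesis
    unfolding ext_pi_well_defined_def
  proof (intro conjI)
    show "\<exists>As \<rho>. pi_choice \<Omega> \<Lambda> A As \<rho>" using c by blast
    show "\<exists>X\<in>ext_graphs \<Omega> \<Lambda>. \<forall>As \<rho>. pi_choice \<Omega> \<Lambda> A As \<rho> \<longrightarrow>
        (\<forall>Y\<in>ext_graphs \<Omega> \<Lambda>. pi_ldigraph \<Omega> \<Lambda> white black A As \<rho> \<in> Y \<longleftrightarrow> Y = X)"
    proof (rule bexI)
      show "ext_orbit \<Omega> (pi_ldigraph \<Omega> \<Lambda> white black A As \<rho>) \<in> ext_graphs \<Omega> \<Lambda>"
        by (rule ext_orbit_pi_ldigraph_in_ext_graphs[OF assms(1,2,3,5) c])
    qed (intro allI impI ballI pi_ldigraph_in_ext_graph_iff[OF assms(1,2,3,5) c])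
  qed
qed

text \<open>Eliminates the definite description: later proofs may compute \<open>ext_pi\<close> from
  whichever choice is convenient.\<close>

lemma ext_pi_eq:
  assumes "finite \<Omega>" "\<Omega> \<subseteq> \<Lambda>" "infinite (\<Lambda> - \<Omega>)" "\<Union> (set ` A) \<subseteq> \<Omega>"
    and c: "pi_choice \<Omega> \<Lambda> A As \<rho>"
  shows "ext_pi \<Omega> \<Lambda> white black A = ext_orbit \<Omega> (pi_ldigraph \<Omega> \<Lambda> white black A As \<rho>)"
  unfolding ext_pi_def
proof (rule the_equality)
  show "ext_orbit \<Omega> (pi_ldigraph \<Omega> \<Lambda> white black A As \<rho>) \<in> ext_graphs \<Omega> \<Lambda> \<and>
    (\<exists>As' \<rho>'. pi_choice \<Omega> \<Lambda> A As' \<rho>' \<and> pi_ldigraph \<Omega> \<Lambda> white black A As' \<rho>' \<in>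
      ext_orbit \<Omega> (pi_ldigraph \<Omega> \<Lambda> white black A As \<rho>))"
    by (intro conjI exI[of _ As] exI[of _ \<rho>] ext_orbit_pi_ldigraph_in_ext_graphs[OF assms]
        ext_orbit_self c)
next
  fix X assume "X \<in> ext_graphs \<Omega> \<Lambda> \<and>
    (\<exists>As' \<rho>'. pi_choice \<Omega> \<Lambda> A As' \<rho>' \<and> pi_ldigraph \<Omega> \<Lambda> white black A As' \<rho>' \<in> X)"
  then obtain As' \<rho>' where "X \<in> ext_graphs \<Omega> \<Lambda>" "pi_choice \<Omega> \<Lambda> A As' \<rho>'"
      "pi_ldigraph \<Omega> \<Lambda> white black A As' \<rho>' \<in> X"
    by (elim conjE exE)
  then show "X = ext_orbit \<Omega> (pi_ldigraph \<Omega> \<Lambda> white black A As \<rho>)"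
    by (simp only: pi_ldigraph_in_ext_graph_iff[OF assms])
qed

section \<open>Invariance\<close>

text \<open>Apply \<open>g\<close> to every list of the enumeration and keep \<open>\<rho>\<close>.
  Lengths are unchanged and \<open>g\<close> fixes the new vertices, so \<open>g\<close> carries the
  digraph of one choice for \<open>A\<close> exactly to that of a choice for the image of
  \<open>A\<close>.\<close>

lemma ext_pi_set_act:
  assumes "finite \<Omega>" "\<Omega> \<subseteq> \<Lambda>" "infinite (\<Lambda> - \<Omega>)" "finite A" "\<Union> (set ` A) \<subseteq> \<Omega>"
    and g: "g \<in> Sym \<Omega>"
  shows "ext_pi \<Omega> \<Lambda> white black (set_act (list_act pt_act) A g) =
    ext_act (ext_pi \<Omega> \<Lambda> white black A) g"
proof -
  have gp: "g permutes \<Omega>" using g by (simp add: Sym_def)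
  obtain As \<rho> where c: "pi_choice \<Omega> \<Lambda> A As \<rho>"
    using pi_choice_exists[OF assms(4,3)] by blast
  have Ag: "set_act (list_act pt_act) A g = map g ` A"
    by (simp add: set_act_def list_act_def pt_act_def)
  have tl: "total_length (map (map g) As) = total_length As"
    by (simp add: total_length_def comp_def)
  have inj: "inj (map g)" using permutes_inj[OF gp] by (rule inj_mapI)
  have "distinct (map (map g) As)"
    using c inj_on_subset[OF inj subset_UNIV] by (simp add: pi_choice_def distinct_map)
  moreover have "set (map (map g) As) = map g ` A - {[]}"
    using c by (auto simp: pi_choice_def)
  moreover have "(SIGMA i:{..<length (map (map g) As)}. {..<length (map (map g) As ! i)}) =
      (SIGMA i:{..<length As}. {..<length (As ! i)})"
    by auto
  ultimately have cg: "pi_choice \<Omega> \<Lambda> (map g ` A) (map (map g) As) \<rho>"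
    using c unfolding pi_choice_def tl by simp
  have fix_new: "g v = v" if "v \<in> pi_new_verts \<Omega> \<Lambda> A As" for v
    using that pi_new_verts_subset[OF assms(3), of A As] permutes_not_in[OF gp] by blast
  \<comment> \<open>Hence the extra vertex is present on both sides or on neither.\<close>
  have "[] \<in> map g ` A \<longleftrightarrow> [] \<in> A" by force
  then have "pi_new_verts \<Omega> \<Lambda> (map g ` A) (map (map g) As) = pi_new_verts \<Omega> \<Lambda> A As"
    by (simp add: pi_new_verts_def tl)
  then have N: "g ` pi_new_verts \<Omega> \<Lambda> A As = pi_new_verts \<Omega> \<Lambda> (map g ` A) (map (map g) As)"
    using fix_new by force
  have arcs: "map_prod g g ` pi_arcs As \<rho> = pi_arcs (map (map g) As) \<rho>"
  proof (rule map_prod_pi_arcs)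
    show "bij_betw id {..<length As} {..<length (map (map g) As)}" by simp
    fix i assume i: "i < length As"
    then show "map (map g) As ! id i = map g (As ! i)" by simp
    fix j assume "j < length (As ! i)"
    then show "\<rho> (id i, j) = g (\<rho> (i, j))"
      using pi_choice_range[OF c i] fix_new by (simp add: pi_new_verts_def)
  qed
  have "ext_act (ext_pi \<Omega> \<Lambda> white black A) g =
      ext_orbit \<Omega> (ldigraph_act (pi_ldigraph \<Omega> \<Lambda> white black A As \<rho>) g)"
    using g by (simp add: ext_pi_eq[OF assms(1,2,3,5) c] ext_act_ext_orbit pi_ldigraph_def)
  also have "\<dots> = ext_orbit \<Omega> (pi_ldigraph \<Omega> \<Lambda> white black (map g ` A) (map (map g) As) \<rho>)"
    using ldigraph_act_pi_ldigraph[OF permutes_bij[OF gp] permutes_image[OF gp] N arcs] by metis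
  also have "\<dots> = ext_pi \<Omega> \<Lambda> white black (map g ` A)"
  proof (rule ext_pi_eq[symmetric, OF assms(1-3) _ cg])
    show "\<Union> (set ` map g ` A) \<subseteq> \<Omega>"
      using assms(5) permutes_image[OF gp] by auto
  qed
  finally show ?thesis by (simp add: Ag)
qed

section \<open>Decoding and injectivity\<close>

text \<open>The list \<open>vs\<close> is a directed path outside \<Omega>. The last two conditions
  on it prevent an extension at either end, so that proper segments of a list are not decoded as
  lists of their own.\<close>

definition decode :: "'a set \<Rightarrow> ('a, 'l) ldigraph \<Rightarrow> 'a list set" where
  "decode \<Omega> \<Gamma> =
     {xs. xs \<noteq> [] \<and> set xs \<subseteq> \<Omega> \<and> (\<exists>vs. length vs = length xs \<and> set vs \<inter> \<Omega> = {} \<and>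
        (\<forall>j<length xs. (vs ! j, xs ! j) \<in> arcs \<Gamma>) \<and>
        (\<forall>j. Suc j < length xs \<longrightarrow> (vs ! j, vs ! Suc j) \<in> arcs \<Gamma>) \<and>
        (\<forall>v. (v, vs ! 0) \<notin> arcs \<Gamma>) \<and>
        (\<forall>v. (vs ! (length xs - 1), v) \<in> arcs \<Gamma> \<longrightarrow> v \<in> \<Omega>))} \<union>
     {xs. xs = [] \<and> (\<exists>v\<in>verts \<Gamma> - \<Omega>. \<forall>w. (v, w) \<notin> arcs \<Gamma>)}"

text \<open>Decoding refers only to arcs and to membership in \<Omega> and in the vertex set, and
  \<open>h\<close> respects all of these while fixing \<Omega> pointwise. One inclusion is enough,
  since injectivity exchanges the two sets of lists.\<close>

lemma decode_ldigraph_act: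
  assumes h: "h \<in> Sym (verts \<Gamma> - \<Omega>)"
  shows "decode \<Omega> \<Gamma> \<subseteq> decode \<Omega> (ldigraph_act \<Gamma> h)"
proof
  have hp: "h permutes verts \<Gamma> - \<Omega>" using h by (simp add: Sym_def)
  let ?\<Delta> = "ldigraph_act \<Gamma> h"
  have fixes_\<Omega>: "h v = v" if "v \<in> \<Omega>" for v using permutes_not_in[OF hp] that by blast
  have h\<Omega>: "h v \<in> \<Omega> \<longleftrightarrow> v \<in> \<Omega>" for v
    using permutes_inj[OF hp] fixes_\<Omega> by (metis injD)
  have arc: "(h a, h b) \<in> arcs ?\<Delta> \<longleftrightarrow> (a, b) \<in> arcs \<Gamma>" for a b
    using inj_image_mem_iff[OF prod.inj_map[OF permutes_inj[OF hp] permutes_inj[OF hp]], of "(a, b)"]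
    by (simp add: ldigraph_act_def)
  \<comment> \<open>With surjectivity, a claim about all arcs at \<open>h v\<close> reduces to arcs
    of \<open>\<Gamma>\<close> at \<open>v\<close>.\<close>
  have ex: "\<exists>u. v = h u" for v using permutes_surj[OF hp] by (metis surjD)
  fix xs assume "xs \<in> decode \<Omega> \<Gamma>"
  then consider "xs = []" "\<exists>v\<in>verts \<Gamma> - \<Omega>. \<forall>w. (v, w) \<notin> arcs \<Gamma>"
    | vs where "xs \<noteq> []" "set xs \<subseteq> \<Omega>" "length vs = length xs" "set vs \<inter> \<Omega> = {}"
      "\<forall>j<length xs. (vs ! j, xs ! j) \<in> arcs \<Gamma>"
      "\<forall>j. Suc j < length xs \<longrightarrow> (vs ! j, vs ! Suc j) \<in> arcs \<Gamma>"
      "\<forall>v. (v, vs ! 0) \<notin> arcs \<Gamma>"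
      "\<forall>v. (vs ! (length xs - 1), v) \<in> arcs \<Gamma> \<longrightarrow> v \<in> \<Omega>"
    by (auto simp: decode_def)
  then show "xs \<in> decode \<Omega> ?\<Delta>"
  proof cases
    case 1
    then obtain v where v: "v \<in> verts \<Gamma> - \<Omega>" "\<forall>w. (v, w) \<notin> arcs \<Gamma>" by blast
    have "h v \<in> verts ?\<Delta> - \<Omega>"
      using v(1) h\<Omega> by (simp add: ldigraph_act_def)
    moreover have "\<forall>w. (h v, w) \<notin> arcs ?\<Delta>" using v(2) arc ex by metis
    ultimately show ?thesis using 1(1) by (auto simp: decode_def)
  next
    case 2
    \<comment> \<open>The image of the path spells the same list, because the entries of
      \<open>xs\<close> lie in \<Omega> and are fixed.\<close>
    let ?ws = "map h vs"
    have nth: "?ws ! j = h (vs ! j)" if "j < length xs" for j using that 2(3) by simp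
    have "\<forall>j<length xs. (?ws ! j, xs ! j) \<in> arcs ?\<Delta>"
    proof (intro allI impI)
      fix j assume j: "j < length xs"
      then have "h (xs ! j) = xs ! j" using 2(2) fixes_\<Omega> nth_mem by blast
      then show "(?ws ! j, xs ! j) \<in> arcs ?\<Delta>" using 2(5) j arc nth by metis
    qed
    moreover have "\<forall>j. Suc j < length xs \<longrightarrow> (?ws ! j, ?ws ! Suc j) \<in> arcs ?\<Delta>"
      using 2(6) arc nth by simp
    moreover have "\<forall>v. (v, ?ws ! 0) \<notin> arcs ?\<Delta>"
      using 2(1,7) arc nth ex by (metis length_greater_0_conv)
    moreover have "\<forall>v. (?ws ! (length xs - 1), v) \<in> arcs ?\<Delta> \<longrightarrow> v \<in> \<Omega>"
      using 2(1,8) arc nth ex h\<Omega> by (metis diff_less length_greater_0_conv zero_less_one)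
    moreover have "set ?ws \<inter> \<Omega> = {}" using 2(4) h\<Omega> by auto
    moreover have "length ?ws = length xs" using 2(3) by simp
    ultimately show ?thesis unfolding decode_def using 2(1,2) by blast
  qed
qed

text \<open>The vertex of a position has exactly one arc into \<Omega>, to the entry there, and at
  most one to a new vertex, that of the next position. A maximal path therefore runs through one
  whole list.\<close>

lemma decode_pi_ldigraph:
  assumes inf: "infinite (\<Lambda> - \<Omega>)" and \<Omega>: "\<Union> (set ` A) \<subseteq> \<Omega>"
    and c: "pi_choice \<Omega> \<Lambda> A As \<rho>"
  shows "decode \<Omega> (pi_ldigraph \<Omega> \<Lambda> white black A As \<rho>) = A"
proof -
  let ?\<Gamma> = "pi_ldigraph \<Omega> \<Lambda> white black A As \<rho>"
  let ?L = "least_elems (\<Lambda> - \<Omega>) (total_length As)"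
  have As: "set As = A - {[]}" using c by (simp add: pi_choice_def)
  have arcs: "arcs ?\<Gamma> = pi_arcs As \<rho>" by (simp add: pi_ldigraph_def)
  have range: "\<rho> (i, j) \<in> ?L" if "i < length As" "j < length (As ! i)" for i j
    using pi_choice_range[OF c that] .
  have new: "\<rho> (i, j) \<notin> \<Omega>" if "i < length As" "j < length (As ! i)" for i j
    using range[OF that] least_elems_subset[OF inf] by blast
  have old: "As ! i ! j \<in> \<Omega>" if "i < length As" "j < length (As ! i)" for i j
  proof -
    have "As ! i \<in> A" using As nth_mem[OF that(1)] by blast
    then show ?thesis using \<Omega> nth_mem[OF that(2)] by blast
  qed
  have label_arc: "(\<rho> (i, j), As ! i ! j) \<in> arcs ?\<Gamma>" if "i < length As" "j < length (As ! i)" for i j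
    using that unfolding arcs pi_arcs_def by blast
  have path_arc: "(\<rho> (i, j), \<rho> (i, Suc j)) \<in> arcs ?\<Gamma>"
    if "i < length As" "Suc j < length (As ! i)" for i j
    using that unfolding arcs pi_arcs_def by blast
  have source: "\<exists>i j. v = \<rho> (i, j) \<and> i < length As \<and> j < length (As ! i)"
    if "(v, w) \<in> arcs ?\<Gamma>" for v w
    using that Suc_lessD unfolding arcs pi_arcs_def by blast
  \<comment> \<open>Injectivity of \<open>\<rho>\<close> recovers the position from the tail of the
    arc; membership of the head in \<Omega> separates the arcs to entries from those along the
    path.\<close>
  have target: "w = As ! i ! j \<and> w \<in> \<Omega> \<or> w = \<rho> (i, Suc j) \<and> Suc j < length (As ! i) \<and> w \<notin> \<Omega>"
    if "i < length As" "j < length (As ! i)" and e: "(\<rho> (i, j), w) \<in> arcs ?\<Gamma>" for i j w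
  proof -
    consider i' j' where "\<rho> (i, j) = \<rho> (i', j')" "w = As ! i' ! j'" "i' < length As"
        "j' < length (As ! i')"
      | i' j' where "\<rho> (i, j) = \<rho> (i', j')" "w = \<rho> (i', Suc j')" "i' < length As"
        "Suc j' < length (As ! i')"
      using e unfolding arcs pi_arcs_def by blast
    then show ?thesis
    proof cases
      case 1
      then show ?thesis using pi_choice_inj[OF c 1(1) that(1,2)] old by blast
    next
      case 2
      then show ?thesis using pi_choice_inj[OF c 2(1) that(1,2)] new by auto
    qed
  qed
  show ?thesis
  proof (intro set_eqI iffI)
    fix xs assume "xs \<in> decode \<Omega> ?\<Gamma>"
    then consider "xs = []" "\<exists>v\<in>verts ?\<Gamma> - \<Omega>. \<forall>w. (v, w) \<notin> arcs ?\<Gamma>"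
      | vs where "xs \<noteq> []" "set xs \<subseteq> \<Omega>" "length vs = length xs" "set vs \<inter> \<Omega> = {}"
        "\<forall>j<length xs. (vs ! j, xs ! j) \<in> arcs ?\<Gamma>"
        "\<forall>j. Suc j < length xs \<longrightarrow> (vs ! j, vs ! Suc j) \<in> arcs ?\<Gamma>"
        "\<forall>v. (v, vs ! 0) \<notin> arcs ?\<Gamma>"
        "\<forall>v. (vs ! (length xs - 1), v) \<in> arcs ?\<Gamma> \<longrightarrow> v \<in> \<Omega>"
      unfolding decode_def by blast
    then show "xs \<in> A"
    proof cases
      case 1
      then obtain v where v: "v \<in> pi_new_verts \<Omega> \<Lambda> A As" "\<forall>w. (v, w) \<notin> arcs ?\<Gamma>"
        by (auto simp: pi_ldigraph_def)
      \<comment> \<open>Every vertex in \<open>?L\<close> has an arc to its entry. A new vertex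
        without outgoing arcs must be the extra one, which exists only if \<open>A\<close> contains
        the empty list.\<close>
      have "v \<notin> ?L"
      proof
        assume "v \<in> ?L"
        then have "v \<in> \<rho> ` (SIGMA i:{..<length As}. {..<length (As ! i)})"
          using c by (simp add: pi_choice_def bij_betw_def)
        then obtain i j where "v = \<rho> (i, j)" "i < length As" "j < length (As ! i)"
          by blast
        then show False using label_arc v(2) by blast
      qed
      then show ?thesis using v(1) 1(1) by (auto simp: pi_new_verts_def split: if_splits)
    next
      case 2
      let ?n = "length xs"
      have n: "0 < ?n" using 2(1) by simp
      have "(vs ! 0, xs ! 0) \<in> arcs ?\<Gamma>" using 2(5) n by blast
      then obtain i j where ij: "vs ! 0 = \<rho> (i, j)" "i < length As" "j < length (As ! i)"
        using source by blast
      \<comment> \<open>Otherwise the vertex of the preceding position would have an arc into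
        \<open>vs ! 0\<close>.\<close>
      have "j = 0"
      proof (cases j)
        case (Suc k)
        then show ?thesis using path_arc[of i k] ij 2(7) by auto
      qed
      \<comment> \<open>Induction along the path: the next vertex lies outside \<Omega>, so
        \<open>target\<close> leaves only the next position of the same list.\<close>
      have path: "k < length (As ! i) \<and> vs ! k = \<rho> (i, k)" if "k < ?n" for k
        using that
      proof (induction k)
        case 0
        then show ?case using ij \<open>j = 0\<close> by simp
      next
        case (Suc k)
        then have k: "k < length (As ! i)" "vs ! k = \<rho> (i, k)" by auto
        have "(\<rho> (i, k), vs ! Suc k) \<in> arcs ?\<Gamma>" using 2(6) Suc.prems k by metis
        moreover have "vs ! Suc k \<in> set vs" using Suc.prems 2(3) by simp
        then have "vs ! Suc k \<notin> \<Omega>" using 2(4) by blast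
        ultimately show ?case using target[OF ij(2) k(1)] by blast
      qed
      \<comment> \<open>If the list went on, the last vertex of \<open>vs\<close> would have an arc
        to a further new vertex, against maximality.\<close>
      have "length (As ! i) = ?n"
      proof (rule ccontr)
        assume "length (As ! i) \<noteq> ?n"
        then have l: "Suc (?n - 1) < length (As ! i)" using path[of "?n - 1"] n by linarith
        then have "\<rho> (i, Suc (?n - 1)) \<in> \<Omega>"
          using path_arc[OF ij(2) l] path[of "?n - 1"] n 2(8) by auto
        then show False using new[OF ij(2) l] by blast
      qed
      moreover have "xs ! k = As ! i ! k" if k: "k < ?n" for k
      proof -
        have "(\<rho> (i, k), xs ! k) \<in> arcs ?\<Gamma>" using 2(5) path[OF k] k by metis
        moreover have "xs ! k \<in> \<Omega>" using 2(2) k nth_mem by blast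
        ultimately show ?thesis using target[OF ij(2)] path[OF k] by blast
      qed
      ultimately have "xs = As ! i" by (simp add: nth_equalityI)
      then show ?thesis using As nth_mem[OF ij(2)] by auto
    qed
  next
    fix xs assume xs: "xs \<in> A"
    show "xs \<in> decode \<Omega> ?\<Gamma>"
    proof (cases "xs = []")
      case True
      let ?v = "enumerate (\<Lambda> - \<Omega>) (total_length As)"
      have "?v \<in> verts ?\<Gamma> - \<Omega>"
        using xs True enumerate_in_set[OF inf] by (auto simp: pi_ldigraph_def pi_new_verts_def)
      \<comment> \<open>All arcs start in the range of \<open>\<rho>\<close>, which avoids the extra
        vertex.\<close>
      moreover have "\<forall>w. (?v, w) \<notin> arcs ?\<Gamma>"
        using source range enumerate_notin_least_elems[OF inf] by metis
      ultimately show ?thesis using True unfolding decode_def by blast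
    next
      case False
      then obtain i where i: "i < length As" "As ! i = xs"
        using As xs by (metis Diff_iff in_set_conv_nth singletonD)
      define vs where "vs = map (\<lambda>j. \<rho> (i, j)) [0..<length xs]"
      have nth: "vs ! j = \<rho> (i, j)" if "j < length xs" for j using that by (simp add: vs_def)
      have n: "0 < length xs" using False by simp
      have "\<forall>j<length xs. (vs ! j, xs ! j) \<in> arcs ?\<Gamma>"
        using label_arc[OF i(1)] nth i(2) by simp
      moreover have "\<forall>j. Suc j < length xs \<longrightarrow> (vs ! j, vs ! Suc j) \<in> arcs ?\<Gamma>"
        using path_arc[OF i(1)] nth i(2) by simp
      \<comment> \<open>An arc into this new vertex would come from a position \<open>j'\<close>
        with \<open>Suc j' = 0\<close>.\<close>
      moreover have "\<forall>v. (v, vs ! 0) \<notin> arcs ?\<Gamma>"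
      proof (intro allI notI)
        fix v assume e: "(v, vs ! 0) \<in> arcs ?\<Gamma>"
        then obtain i' j' where ij': "v = \<rho> (i', j')" "i' < length As" "j' < length (As ! i')"
          using source by blast
        have "vs ! 0 \<notin> \<Omega>" using nth[OF n] new[OF i(1)] i(2) n by simp
        then have "\<rho> (i, 0) = \<rho> (i', Suc j')" "Suc j' < length (As ! i')"
          using target[OF ij'(2,3)] e ij'(1) nth[OF n] by auto
        then show False using pi_choice_inj[OF c _ i(1) _ ij'(2)] i(2) n by blast
      qed
      moreover have "\<forall>v. (vs ! (length xs - 1), v) \<in> arcs ?\<Gamma> \<longrightarrow> v \<in> \<Omega>"
        using target[OF i(1), of "length xs - 1"] nth[of "length xs - 1"] i(2) n by auto
      moreover have "set vs \<inter> \<Omega> = {}" using new[OF i(1)] i(2) by (auto simp: vs_def)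
      moreover have "length vs = length xs" by (simp add: vs_def)
      moreover have "set xs \<subseteq> \<Omega>" using \<Omega> xs by blast
      ultimately show ?thesis unfolding decode_def using False by blast
    qed
  qed
qed

lemma inj_on_ext_pi:
  assumes "finite \<Omega>" "\<Omega> \<subseteq> \<Lambda>" "infinite (\<Lambda> - \<Omega>)"
  shows "inj_on (ext_pi \<Omega> \<Lambda> white black) (Fpow (lists \<Omega>))"
proof -
  have sub: "A \<subseteq> B"
    if A: "finite A" "\<Union> (set ` A) \<subseteq> \<Omega>" and B: "finite B" "\<Union> (set ` B) \<subseteq> \<Omega>"
      and eq: "ext_pi \<Omega> \<Lambda> white black A = ext_pi \<Omega> \<Lambda> white black B" for A B
  proof -
    obtain As \<rho> Bs \<rho>' where cA: "pi_choice \<Omega> \<Lambda> A As \<rho>" and cB: "pi_choice \<Omega> \<Lambda> B Bs \<rho>'"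
      using pi_choice_exists A(1) B(1) assms(3) by metis
    let ?\<Gamma> = "pi_ldigraph \<Omega> \<Lambda> white black A As \<rho>"
    let ?\<Delta> = "pi_ldigraph \<Omega> \<Lambda> white black B Bs \<rho>'"
    \<comment> \<open>The two values of \<open>ext_pi\<close> are the orbits of
      \<open>?\<Gamma>\<close> and \<open>?\<Delta>\<close>, and each orbit contains its
      representative.\<close>
    have "?\<Delta> \<in> ext_orbit \<Omega> ?\<Gamma>"
      using eq ext_orbit_self by (metis ext_pi_eq assms A(2) B(2) cA cB)
    then obtain h where "h \<in> Sym (verts ?\<Gamma> - \<Omega>)" "?\<Delta> = ldigraph_act ?\<Gamma> h"
      unfolding ext_orbit_def by blast
    then have "decode \<Omega> ?\<Gamma> \<subseteq> decode \<Omega> ?\<Delta>" using decode_ldigraph_act by metis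
    then show ?thesis
      using decode_pi_ldigraph[OF assms(3) A(2) cA] decode_pi_ldigraph[OF assms(3) B(2) cB] by metis
  qed
  show ?thesis
  proof (rule inj_onI)
    fix A B assume "A \<in> Fpow (lists \<Omega>)" "B \<in> Fpow (lists \<Omega>)"
      and eq: "ext_pi \<Omega> \<Lambda> white black A = ext_pi \<Omega> \<Lambda> white black B"
    then have "finite A" "\<Union> (set ` A) \<subseteq> \<Omega>" "finite B" "\<Union> (set ` B) \<subseteq> \<Omega>"
      by (auto simp: Fpow_def)
    then show "A = B" using sub eq by (metis subset_antisym)
  qed
qed

section \<open>Perfect refiners from injective invariant maps\<close>

text \<open>For stacks of equal length, mapping \<open>S @ [x]\<close> to \<open>T @ [y]\<close>
  splits into mapping \<open>S\<close> to \<open>T\<close> and \<open>x\<close> to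
  \<open>y\<close>.\<close>

lemma perfect_refiner_const:
  assumes "x \<in> X" "y \<in> X" "U = Transp \<Omega> act x y"
  shows "perfect_refiner \<Omega> X act U (\<lambda>_. [x]) (\<lambda>_. [y])"
  using assms by (auto simp: perfect_refiner_def refiner_def Transp_def list_act_def)

text \<open>Invariance turns the image of \<open>actX x g\<close> into \<open>actY (f x) g\<close>,
  and injectivity cancels \<open>f\<close>. Closure puts \<open>actX x g\<close> into
  \<open>X\<close>, where \<open>f\<close> is injective.\<close>

lemma Transp_transfer:
  assumes inv: "Sym_invariant \<Omega> actX actY X f" and inj: "inj_on f X"
    and "x \<in> X" "y \<in> X" and closed: "\<And>g. g \<in> Sym \<Omega> \<Longrightarrow> actX x g \<in> X"
  shows "Transp \<Omega> actX x y = Transp \<Omega> actY (f x) (f y)"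
proof -
  have "actX x g = y \<longleftrightarrow> actY (f x) g = f y" if "g \<in> Sym \<Omega>" for g
    using inv inj_on_eq_iff[OF inj closed[OF that] \<open>y \<in> X\<close>] that \<open>x \<in> X\<close>
    by (simp add: Sym_invariant_def)
  then show ?thesis by (auto simp: Transp_def)
qed

lemma set_act_list_act_in_Fpow:
  assumes "g \<in> Sym \<Omega>" "A \<in> Fpow (lists \<Omega>)"
  shows "set_act (list_act pt_act) A g \<in> Fpow (lists \<Omega>)"
proof -
  have "\<And>x. x \<in> \<Omega> \<Longrightarrow> g x \<in> \<Omega>" using assms(1) by (simp add: Sym_def permutes_in_image)
  then show ?thesis
    using assms(2) by (force simp: Fpow_def set_act_def list_act_def pt_act_def)
qed

theorem mainTheorem6:
  fixes \<Omega> \<Lambda> :: "'a::wellorder set" and white black :: "'l"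
  assumes "finite \<Omega>" and "\<Omega> \<noteq> {}"
    and "infinite \<Lambda>" and "\<Omega> \<subseteq> \<Lambda>" and "\<forall>\<alpha>\<in>\<Omega>. \<forall>\<beta>\<in>\<Lambda> - \<Omega>. \<alpha> < \<beta>"
    and "white \<noteq> black"
  shows "(\<forall>A\<in>Fpow (lists \<Omega>). ext_pi_well_defined \<Omega> \<Lambda> white black A) \<and>
    ext_pi \<Omega> \<Lambda> white black \<in> Fpow (lists \<Omega>) \<rightarrow> ext_graphs \<Omega> \<Lambda> \<and>
    inj_on (ext_pi \<Omega> \<Lambda> white black) (Fpow (lists \<Omega>)) \<and>
    Sym_invariant \<Omega> (set_act (list_act pt_act)) ext_act (Fpow (lists \<Omega>))
      (ext_pi \<Omega> \<Lambda> white black) \<and>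
    (\<forall>A\<in>Fpow (lists \<Omega>). \<forall>B\<in>Fpow (lists \<Omega>).
      perfect_refiner \<Omega> (ext_graphs \<Omega> \<Lambda>) ext_act
        (Transp \<Omega> (set_act (list_act pt_act)) A B)
        (\<lambda>_. [ext_pi \<Omega> \<Lambda> white black A]) (\<lambda>_. [ext_pi \<Omega> \<Lambda> white black B]))"
proof -
  let ?F = "Fpow (lists \<Omega>)" and ?\<pi> = "ext_pi \<Omega> \<Lambda> white black"
  have inf: "infinite (\<Lambda> - \<Omega>)" using assms(1,3) by simp
  note ctx = assms(1,4) inf
  have F: "finite A" "\<Union> (set ` A) \<subseteq> \<Omega>" if "A \<in> ?F" for A
    using that by (auto simp: Fpow_def)
  have wd: "\<forall>A\<in>?F. ext_pi_well_defined \<Omega> \<Lambda> white black A"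
    using ext_pi_well_definedI[OF ctx] F by metis
  have mem: "?\<pi> A \<in> ext_graphs \<Omega> \<Lambda>" if "A \<in> ?F" for A
    using pi_choice_exists[OF F(1)[OF that] inf] ext_pi_eq[OF ctx F(2)[OF that]]
      ext_orbit_pi_ldigraph_in_ext_graphs[OF ctx F(2)[OF that]] by metis
  have inj: "inj_on ?\<pi> ?F" by (rule inj_on_ext_pi[OF ctx])
  have inv: "Sym_invariant \<Omega> (set_act (list_act pt_act)) ext_act ?F ?\<pi>"
    unfolding Sym_invariant_def using ext_pi_set_act[OF ctx] F by metis
  \<comment> \<open>The transporter of \<open>A\<close> to \<open>B\<close> equals that of their
    images under \<open>?\<pi>\<close>, for which the constant functions form a perfect
    refiner.\<close>
  have "perfect_refiner \<Omega> (ext_graphs \<Omega> \<Lambda>) ext_act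
      (Transp \<Omega> (set_act (list_act pt_act)) A B) (\<lambda>_. [?\<pi> A]) (\<lambda>_. [?\<pi> B])"
    if A: "A \<in> ?F" and B: "B \<in> ?F" for A B
    by (rule perfect_refiner_const[OF mem[OF A] mem[OF B]
          Transp_transfer[OF inv inj A B set_act_list_act_in_Fpow[OF _ A]]])
  then show ?thesis using wd mem inj inv by blast
qed

end
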